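(* For every constant $c>0$ there exist constants $0<a\le A$ depending only on $c$ such that for all positive integers $S,n$ with $n\ge cS$, $$a\,\frac Sn\le\sup_{P,Q\in\mathcal{M}_S}\mathbb{E}_P\big|\|P_n-Q\|_1-\|P-Q\|_1\big|^2\le A\,\frac Sn .$$
   Context: $\mathcal{M}_S$ is the set of probability vectors on $\{1,\dots,S\}$; $\|P-Q\|_1=\sum_{i=1}^S|p_i-q_i|$. Poisson sampling model with $Q$ known: for $P=(p_i)$ one observes mutually independent $X_i\sim\mathrm{Poi}(np_i)$, $1\le i\le S$, and sets $\hat p_i=X_i/n$, $P_n=(\hat p_1,\dots,\hat p_S)$, so that $\|P_n-Q\|_1=\sum_i|\hat p_i-q_i|$ is the plug-in estimator. *)

theory Defs
  imports "HOL-Probability.Probability"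
begin

definition prob_vectors :: "nat \<Rightarrow> (nat \<Rightarrow> real) set" where
  "prob_vectors S = {p \<in> {1..S} \<rightarrow>\<^sub>E {0..}. (\<Sum>i=1..S. p i) = 1}"

definition l1_dist :: "nat \<Rightarrow> (nat \<Rightarrow> real) \<Rightarrow> (nat \<Rightarrow> real) \<Rightarrow> real" where
  "l1_dist S p q = (\<Sum>i=1..S. \<bar>p i - q i\<bar>)"

(* The library's poisson_pmf is only specified for positive rates; a probability
   vector may have zero entries, and Poi(0) is the point mass at 0. *)
definition Poi :: "real \<Rightarrow> nat pmf" where
  "Poi r = (if r = 0 then return_pmf 0 else poisson_pmf r)"

lemma pmf_Poi: "r \<ge> 0 \<Longrightarrow> pmf (Poi r) k = r ^ k / fact k * exp (-r)"
  by (cases "k = 0") (auto simp: Poi_def)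

(* Joint law of the counts X_1, ..., X_S, independent with X_i ~ Poi(n p_i);
   the value 0 at indices outside {1..S} is a dummy. *)
definition poisson_sample :: "nat \<Rightarrow> nat \<Rightarrow> (nat \<Rightarrow> real) \<Rightarrow> (nat \<Rightarrow> nat) pmf" where
  "poisson_sample S n p = Pi_pmf {1..S} 0 (\<lambda>i. Poi (real n * p i))"

definition empirical :: "nat \<Rightarrow> (nat \<Rightarrow> nat) \<Rightarrow> nat \<Rightarrow> real" where
  "empirical n X i = real (X i) / real n"

(* Expectation and supremum are taken in the extended nonnegative reals, so that neither
   integrability nor boundedness is presupposed. *)
definition plugin_risk :: "nat \<Rightarrow> nat \<Rightarrow> (nat \<Rightarrow> real) \<Rightarrow> (nat \<Rightarrow> real) \<Rightarrow> ennreal" where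
  "plugin_risk S n p q =
     (\<integral>\<^sup>+X. ennreal (\<bar>l1_dist S (empirical n X) q - l1_dist S p q\<bar>\<^sup>2)
        \<partial>measure_pmf (poisson_sample S n p))"

end

theory Submission
  imports Defs
begin

text \<open>
  The plug-in estimator depends on the sample only through the \<open>l1\<close>-distance to \<open>Q\<close>, which is
  1-Lipschitz in its first argument. Hence, whatever \<open>Q\<close> is, its error is at most
  \<open>\<Sum>i. \<bar>empirical i - P i\<bar>\<close>, and by Cauchy-Schwarz the squared error is at most \<open>S\<close> times the
  squared Euclidean error. The latter has expectation \<open>\<Sum>i. P i / n = 1 / n\<close>, because a Poisson
  variable has variance equal to its mean. This gives the upper bound \<open>S / n\<close>
  (\<open>plugin_risk_upper\<close>).

  The Lipschitz bound is attained when \<open>Q = P\<close>: the true distance is then \<open>0\<close> and the estimator is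
  exactly \<open>\<Sum>i. \<bar>empirical i - P i\<bar>\<close>, with no cancellation. For \<open>P = Q\<close> uniform, Jensen's inequality
  bounds the risk below by the squared mean, \<open>(S / n * E \<bar>X - r\<bar>)\<^sup>2\<close> with \<open>X\<close> Poisson of rate
  \<open>r = n / S\<close>. Since \<open>r \<ge> c\<close>, the mean absolute deviation is still of the order \<open>sqrt r\<close> of the
  standard deviation (\<open>Poi_mean_abs_deviation_lower\<close>), and the bound is a constant times
  \<open>(S / n)\<^sup>2 * r = S / n\<close> (\<open>plugin_risk_uniform_lower\<close>). A lower bound on the rate is essential here:
  as \<open>r\<close> tends to \<open>0\<close>, the mean absolute deviation is only of order \<open>r\<close>.
\<close>

section \<open>Moments of the Poisson distribution\<close>

text \<open>
  The Stein--Chen identity \<open>E (X f(X)) = r E f(X + 1)\<close>, which holds because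
  \<open>(k + 1) pmf(k + 1) = r pmf(k)\<close>. Taking \<open>f\<close> a power expresses each moment of the Poisson law
  through the lower ones. With \<open>f\<close> nonnegative, integrability of the right-hand side yields that of
  the left-hand side.
\<close>
lemma Poi_stein:
  fixes f :: "nat \<Rightarrow> real"
  assumes r: "r \<ge> 0" and f: "\<And>k. f k \<ge> 0"
    and L: "has_bochner_integral (measure_pmf (Poi r)) (\<lambda>k. f (Suc k)) L"
  shows "has_bochner_integral (measure_pmf (Poi r)) (\<lambda>k. real k * f k) (r * L)"
proof -
  let ?p = "pmf (Poi r)"
  have shift: "?p (Suc k) * (real (Suc k) * f (Suc k)) = r * (?p k * f (Suc k))" for k
    using r by (simp add: pmf_Poi field_simps del: of_nat_Suc)
  have L0: "L \<ge> 0"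
    using L f by (auto simp: has_bochner_integral_iff intro!: integral_nonneg)
  have "(\<integral>\<^sup>+k. ennreal (real k * f k) \<partial>measure_pmf (Poi r))
      = (\<Sum>k. ennreal (?p k * (real k * f k)))"
    by (simp add: nn_integral_measure_pmf nn_integral_count_space_nat ennreal_mult' f)
  also have "\<dots> = (\<Sum>k. ennreal (?p (Suc k) * (real (Suc k) * f (Suc k))))"
    by (subst suminf_offset[where i = 1]) (auto simp: summableI)
  also have "\<dots> = (\<Sum>k. ennreal r * (ennreal (?p k) * ennreal (f (Suc k))))"
    unfolding shift using r f by (simp add: ennreal_mult')
  also have "\<dots> = ennreal r * (\<integral>\<^sup>+k. ennreal (f (Suc k)) \<partial>measure_pmf (Poi r))"
    by (simp add: nn_integral_measure_pmf nn_integral_count_space_nat ennreal_suminf_cmult)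
  also have "(\<integral>\<^sup>+k. ennreal (f (Suc k)) \<partial>measure_pmf (Poi r)) = ennreal L"
    using L f by (auto simp: has_bochner_integral_iff nn_integral_eq_integral)
  also have "ennreal r * ennreal L = ennreal (r * L)"
    using r by (simp add: ennreal_mult')
  finally show ?thesis
    using r f L0 by (intro has_bochner_integral_nn_integral) auto
qed

text \<open>
  The raw moments \<open>m1, ..., m4\<close> come from one another by the Stein--Chen identity; the central
  moments follow by expanding the power of \<open>k - r\<close>.
\<close>
lemma
  assumes r: "r \<ge> 0"
  shows Poi_variance:
      "has_bochner_integral (measure_pmf (Poi r)) (\<lambda>k. (real k - r)\<^sup>2) r"
    and Poi_fourth_central_moment:
      "has_bochner_integral (measure_pmf (Poi r)) (\<lambda>k. (real k - r) ^ 4) (r + 3 * r\<^sup>2)"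
proof -
  let ?E = "has_bochner_integral (measure_pmf (Poi r))"
  have m0: "?E (\<lambda>_. a) a" for a :: real
    by (simp add: has_bochner_integral_iff)
  have m1: "?E real r"
    using Poi_stein[of r "\<lambda>_. 1" 1] r m0 by simp
  have m2: "?E (\<lambda>k. real k ^ 2) (r + r\<^sup>2)"
    using Poi_stein[of r real "r + 1"] has_bochner_integral_add[OF m1 m0[of 1]] r
    by (simp add: algebra_simps power2_eq_square)
  have m3: "?E (\<lambda>k. real k ^ 3) (r * (r + r\<^sup>2 + (2 * r + 1)))"
    using Poi_stein[of r "\<lambda>k. real k ^ 2" "r + r\<^sup>2 + (2 * r + 1)"] r
      has_bochner_integral_add[OF m2 has_bochner_integral_add
        [OF has_bochner_integral_mult_right[of 2, OF m1] m0[of 1]]]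
    by (simp add: algebra_simps power2_eq_square power3_eq_cube)
  have m4: "?E (\<lambda>k. real k ^ 4)
      (r * (r * (r + r\<^sup>2 + (2 * r + 1)) + (3 * (r + r\<^sup>2) + (3 * r + 1))))"
    using Poi_stein[of r "\<lambda>k. real k ^ 3"
        "r * (r + r\<^sup>2 + (2 * r + 1)) + (3 * (r + r\<^sup>2) + (3 * r + 1))"] r
      has_bochner_integral_add[OF m3 has_bochner_integral_add
        [OF has_bochner_integral_mult_right[of 3, OF m2] has_bochner_integral_add
          [OF has_bochner_integral_mult_right[of 3, OF m1] m0[of 1]]]]
    by (simp add: algebra_simps power2_eq_square power3_eq_cube power4_eq_xxxx)
  show "?E (\<lambda>k. (real k - r)\<^sup>2) r"
    using has_bochner_integral_add[OF m2 has_bochner_integral_add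
        [OF has_bochner_integral_mult_right[of "- 2 * r", OF m1] m0[of "r\<^sup>2"]]]
    by (simp add: algebra_simps power2_eq_square)
  show "?E (\<lambda>k. (real k - r) ^ 4) (r + 3 * r\<^sup>2)"
    using has_bochner_integral_add[OF m4 has_bochner_integral_add
        [OF has_bochner_integral_mult_right[of "- 4 * r", OF m3] has_bochner_integral_add
          [OF has_bochner_integral_mult_right[of "6 * r\<^sup>2", OF m2] has_bochner_integral_add
            [OF has_bochner_integral_mult_right[of "- 4 * r ^ 3", OF m1] m0[of "r ^ 4"]]]]]
    by (simp add: algebra_simps power2_eq_square power3_eq_cube power4_eq_xxxx)
qed

section \<open>Mean absolute deviation of the Poisson distribution\<close>

text \<open>
  A bounded kurtosis prevents the variance from being carried by rare large deviations, so it forces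
  a mean absolute deviation comparable to the standard deviation. Here the kurtosis is
  \<open>3 + 1 / r \<le> 3 + 1 / c\<close>. The comparison is made by integrating the pointwise inequality
  \<open>\<bar>y\<bar> \<ge> y\<^sup>2 / s - y\<^sup>4 / s\<^sup>3\<close> for a scale \<open>s\<close> proportional to \<open>sqrt r\<close>.
\<close>
lemma Poi_mean_abs_deviation_lower:
  assumes c: "c > 0" and r: "r \<ge> c"
  shows "integrable (measure_pmf (Poi r)) (\<lambda>k. \<bar>real k - r\<bar>)"
    and "sqrt (r / (8 * (3 + 1 / c))) \<le> measure_pmf.expectation (Poi r) (\<lambda>k. \<bar>real k - r\<bar>)"
proof -
  have r0: "r > 0" using c r by simp
  note V = Poi_variance[of r] and F = Poi_fourth_central_moment[of r]
  show int: "integrable (measure_pmf (Poi r)) (\<lambda>k. \<bar>real k - r\<bar>)"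
  proof (rule Bochner_Integration.integrable_bound)
    show "integrable (measure_pmf (Poi r)) (\<lambda>k. 1 + (real k - r)\<^sup>2)"
      using V r0 by (auto simp: has_bochner_integral_iff)
    have "\<bar>y\<bar> \<le> 1 + y\<^sup>2" for y :: real
    proof -
      have "0 \<le> (\<bar>y\<bar> - 1 / 2)\<^sup>2" by simp
      also have "\<dots> = y\<^sup>2 - \<bar>y\<bar> + 1 / 4" by (simp add: power2_diff power_divide)
      finally show ?thesis by linarith
    qed
    then show "AE k in measure_pmf (Poi r). norm \<bar>real k - r\<bar> \<le> norm (1 + (real k - r)\<^sup>2)"
      by simp
  qed simp
  (* The scale s is chosen such that the fourth-moment term consumes at most half of the
     second-moment term. *)
  define K where "K = 2 * (3 + 1 / c)"
  define s where "s = sqrt (K * r)"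
  have K0: "K > 0" using c by (simp add: K_def add_pos_pos)
  have s0: "s > 0" and s2: "s\<^sup>2 = K * r" using K0 r0 by (simp_all add: s_def)
  (* For u = |y| / s this is u^2 - u^4 <= u: if u <= 1 then already u^2 <= u, and otherwise the
     left-hand side is negative. *)
  have ptw: "(1 / s) * y\<^sup>2 + (- 1 / s ^ 3) * y ^ 4 \<le> \<bar>y\<bar>" for y :: real
  proof -
    define u where "u = \<bar>y\<bar> / s"
    have u0: "u \<ge> 0" using s0 by (simp add: u_def)
    have "u\<^sup>2 - u ^ 4 \<le> u"
    proof (cases "u \<le> 1")
      case True
      then have "u\<^sup>2 \<le> u" using u0 by (simp add: power2_eq_square mult_left_le)
      moreover have "u ^ 4 \<ge> 0" using u0 by simp
      ultimately show ?thesis by linarith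
    next
      case False
      then have "u\<^sup>2 \<le> u ^ 4" by (intro power_increasing) auto
      then show ?thesis using u0 by linarith
    qed
    then have "s * (u\<^sup>2 - u ^ 4) \<le> s * u" using s0 by simp
    moreover have "s * u = \<bar>y\<bar>" using s0 by (simp add: u_def)
    moreover have "s * (u\<^sup>2 - u ^ 4) = (1 / s) * y\<^sup>2 + (- 1 / s ^ 3) * y ^ 4"
      using s0 by (simp add: u_def field_simps power_divide power2_eq_square power3_eq_cube
          power4_eq_xxxx)
    ultimately show ?thesis by simp
  qed
  have "has_bochner_integral (measure_pmf (Poi r))
      (\<lambda>k. (1 / s) * (real k - r)\<^sup>2 + (- 1 / s ^ 3) * (real k - r) ^ 4)
      ((1 / s) * r + (- 1 / s ^ 3) * (r + 3 * r\<^sup>2))"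
    using V F r0 by (intro has_bochner_integral_add has_bochner_integral_mult_right) auto
  then have lower: "(1 / s) * r + (- 1 / s ^ 3) * (r + 3 * r\<^sup>2)
      \<le> measure_pmf.expectation (Poi r) (\<lambda>k. \<bar>real k - r\<bar>)"
    using integral_mono[OF _ int ptw] by (auto simp: has_bochner_integral_iff)
  have "r + 3 * r\<^sup>2 \<le> K / 2 * r\<^sup>2"
  proof -
    have "r * c \<le> r * r" using r r0 by simp
    then show ?thesis using c by (simp add: K_def field_simps power2_eq_square)
  qed
  also have "\<dots> = s ^ 3 * (r / (2 * s))"
    using s0 s2 by (simp add: power3_eq_cube power2_eq_square field_simps)
  finally have "1 / s ^ 3 * (r + 3 * r\<^sup>2) \<le> r / (2 * s)"
    using s0 by (simp add: field_simps)
  then have "r / (2 * s) \<le> (1 / s) * r + (- 1 / s ^ 3) * (r + 3 * r\<^sup>2)"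
    using s0 by (simp add: field_simps)
  moreover have "sqrt (r / (8 * (3 + 1 / c))) = r / (2 * s)"
  proof (rule real_sqrt_unique)
    have "(r / (2 * s))\<^sup>2 = r\<^sup>2 / (4 * (K * r))"
      by (simp add: power_divide power_mult_distrib s2)
    also have "\<dots> = r / (4 * K)"
      using r0 by (simp add: power2_eq_square)
    finally show "(r / (2 * s))\<^sup>2 = r / (8 * (3 + 1 / c))"
      by (simp add: K_def)
  qed (use r0 s0 in auto)
  ultimately show "sqrt (r / (8 * (3 + 1 / c)))
      \<le> measure_pmf.expectation (Poi r) (\<lambda>k. \<bar>real k - r\<bar>)"
    using lower by linarith
qed

section \<open>Risk of the plug-in estimator\<close>

lemma poisson_sample_component:
  fixes g :: "nat \<Rightarrow> real"
  assumes "i \<in> {1..S}" and "has_bochner_integral (measure_pmf (Poi (real n * p i))) g a"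
  shows "has_bochner_integral (measure_pmf (poisson_sample S n p)) (\<lambda>X. g (X i)) a"
proof -
  have "Poi (real n * p i) = map_pmf (\<lambda>X. X i) (poisson_sample S n p)"
    using assms(1) by (simp add: poisson_sample_def Pi_pmf_component)
  then show ?thesis
    using assms(2) by (simp add: has_bochner_integral_iff)
qed

text \<open>
  Coordinate \<open>i\<close> contributes the variance \<open>n p i / n\<^sup>2 = p i / n\<close>, and the \<open>p i\<close> add up to \<open>1\<close>; so
  the mean squared Euclidean error is the same for all \<open>p\<close>.
\<close>
lemma poisson_sample_l2_error:
  assumes p: "p \<in> prob_vectors S" and n: "n > 0"
  shows "has_bochner_integral (measure_pmf (poisson_sample S n p))
    (\<lambda>X. \<Sum>i=1..S. (empirical n X i - p i)\<^sup>2) (1 / real n)"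
proof -
  have "has_bochner_integral (measure_pmf (poisson_sample S n p))
      (\<lambda>X. (empirical n X i - p i)\<^sup>2) (p i / real n)" if i: "i \<in> {1..S}" for i
  proof -
    have "p i \<ge> 0" using p i by (auto simp: prob_vectors_def PiE_def Pi_def)
    then have "has_bochner_integral (measure_pmf (Poi (real n * p i)))
        (\<lambda>k. 1 / (real n)\<^sup>2 * (real k - real n * p i)\<^sup>2) (1 / (real n)\<^sup>2 * (real n * p i))"
      by (intro has_bochner_integral_mult_right Poi_variance) auto
    moreover have "1 / (real n)\<^sup>2 * (real k - real n * p i)\<^sup>2 = (real k / real n - p i)\<^sup>2" for k
      using n by (simp add: field_simps flip: power_divide)
    moreover have "1 / (real n)\<^sup>2 * (real n * p i) = p i / real n"
      using n by (simp add: power2_eq_square)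
    ultimately show ?thesis
      using poisson_sample_component[OF i] by (simp add: empirical_def)
  qed
  then have "has_bochner_integral (measure_pmf (poisson_sample S n p))
      (\<lambda>X. \<Sum>i=1..S. (empirical n X i - p i)\<^sup>2) (\<Sum>i=1..S. p i / real n)"
    by (intro has_bochner_integral_sum)
  also have "(\<Sum>i=1..S. p i / real n) = 1 / real n"
    using p by (simp add: prob_vectors_def flip: sum_divide_distrib)
  finally show ?thesis .
qed

text \<open>
  The reverse triangle inequality in each coordinate makes \<open>q\<close> disappear; Cauchy-Schwarz then
  passes to the Euclidean error, whose mean needs only second moments.
\<close>
lemma l1_dist_lipschitz_sq:
  "\<bar>l1_dist S p' q - l1_dist S p q\<bar>\<^sup>2 \<le> real S * (\<Sum>i=1..S. (p' i - p i)\<^sup>2)"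
proof -
  have "\<bar>l1_dist S p' q - l1_dist S p q\<bar> \<le> (\<Sum>i=1..S. \<bar>p' i - p i\<bar>)"
    unfolding l1_dist_def sum_subtractf[symmetric]
    by (rule order.trans[OF sum_abs]) (intro sum_mono, auto)
  then have "\<bar>l1_dist S p' q - l1_dist S p q\<bar>\<^sup>2 \<le> (\<Sum>i=1..S. \<bar>p' i - p i\<bar>)\<^sup>2"
    by (intro power_mono) auto
  also have "\<dots> \<le> real S * (\<Sum>i=1..S. (p' i - p i)\<^sup>2)"
    using sum_squared_le_sum_of_squares[of "\<lambda>i. \<bar>p' i - p i\<bar>" "{1..S}"] by (simp add: mult.commute)
  finally show ?thesis .
qed

lemma plugin_risk_upper:
  assumes p: "p \<in> prob_vectors S" and n: "n > 0"
  shows "plugin_risk S n p q \<le> ennreal (real S / real n)"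
proof -
  let ?err = "\<lambda>X. real S * (\<Sum>i=1..S. (empirical n X i - p i)\<^sup>2)"
  have err: "has_bochner_integral (measure_pmf (poisson_sample S n p)) ?err (real S * (1 / real n))"
    by (intro has_bochner_integral_mult_right poisson_sample_l2_error p n)
  have "plugin_risk S n p q \<le> (\<integral>\<^sup>+X. ennreal (?err X) \<partial>measure_pmf (poisson_sample S n p))"
    unfolding plugin_risk_def
    by (intro nn_integral_mono ennreal_leI l1_dist_lipschitz_sq)
  also have "\<dots> = ennreal (real S * (1 / real n))"
    using err by (subst nn_integral_eq_integral)
      (auto simp: has_bochner_integral_iff intro!: mult_nonneg_nonneg sum_nonneg)
  finally show ?thesis by simp
qed

text \<open>
  At the uniform distribution all \<open>S\<close> cells have the same rate \<open>n / S \<ge> c\<close>, so that the bound on the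
  mean absolute deviation applies to each of them.
\<close>
lemma plugin_risk_uniform_lower:
  assumes c: "c > 0" and S: "S > 0" and n: "n > 0" and cS: "real n \<ge> c * real S"
  defines "u \<equiv> \<lambda>i\<in>{1..S}. 1 / real S"
  shows "u \<in> prob_vectors S"
    and "ennreal (1 / (8 * (3 + 1 / c)) * (real S / real n)) \<le> plugin_risk S n u u"
proof -
  show u: "u \<in> prob_vectors S"
    using S by (auto simp: u_def prob_vectors_def)
  define r where "r = real n / real S"
  define \<delta> where "\<delta> = measure_pmf.expectation (Poi r) (\<lambda>k. \<bar>real k - r\<bar>)"
  define m where "m = real S / real n * \<delta>"
  define Z where "Z = (\<lambda>X. l1_dist S (empirical n X) u)"
  let ?M = "measure_pmf (poisson_sample S n u)"
  have r: "r \<ge> c" using cS S by (simp add: r_def field_simps)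
  note dev = Poi_mean_abs_deviation_lower[OF c r]
  have "has_bochner_integral ?M (\<lambda>X. \<bar>empirical n X i - u i\<bar>) (1 / real n * \<delta>)"
    if i: "i \<in> {1..S}" for i
  proof -
    have "has_bochner_integral (measure_pmf (Poi r))
        (\<lambda>k. 1 / real n * \<bar>real k - r\<bar>) (1 / real n * \<delta>)"
      using dev(1) by (intro has_bochner_integral_mult_right) (auto simp: has_bochner_integral_iff \<delta>_def)
    moreover have "1 / real n * \<bar>real k - r\<bar> = \<bar>real k / real n - u i\<bar>" for k
    proof -
      have "real k / real n - u i = (1 / real n) * (real k - r)"
        using i n S by (simp add: u_def r_def field_simps)
      then show ?thesis by (simp add: abs_mult)
    qed
    moreover have "real n * u i = r"
      using i by (simp add: u_def r_def)
    ultimately show ?thesis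
      using poisson_sample_component[OF i, of n u] by (simp add: empirical_def)
  qed
  then have "has_bochner_integral ?M Z (\<Sum>i=1..S. 1 / real n * \<delta>)"
    unfolding Z_def l1_dist_def by (intro has_bochner_integral_sum)
  then have EZ: "has_bochner_integral ?M Z m"
    by (simp add: m_def)
  have l1_uu: "l1_dist S u u = 0"
    by (simp add: l1_dist_def)
  have Z2: "integrable ?M (\<lambda>X. (Z X)\<^sup>2)"
  proof (rule Bochner_Integration.integrable_bound)
    show "integrable ?M (\<lambda>X. real S * (\<Sum>i=1..S. (empirical n X i - u i)\<^sup>2))"
      using poisson_sample_l2_error[OF u n] by (auto simp: has_bochner_integral_iff)
    have "(Z X)\<^sup>2 \<le> real S * (\<Sum>i=1..S. (empirical n X i - u i)\<^sup>2)" for X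
      using l1_dist_lipschitz_sq[of S "empirical n X" u u] by (simp add: Z_def l1_uu)
    then show "AE X in ?M. norm ((Z X)\<^sup>2)
        \<le> norm (real S * (\<Sum>i=1..S. (empirical n X i - u i)\<^sup>2))"
      by (auto intro: order.trans[OF _ abs_ge_self])
  qed simp
  have "0 \<le> measure_pmf.variance (poisson_sample S n u) Z"
    by (rule measure_pmf.variance_positive)
  then have jensen: "m\<^sup>2 \<le> measure_pmf.expectation (poisson_sample S n u) (\<lambda>X. (Z X)\<^sup>2)"
    using EZ Z2 by (subst (asm) measure_pmf.variance_eq) (auto simp: has_bochner_integral_iff)
  have "r / (8 * (3 + 1 / c)) = (sqrt (r / (8 * (3 + 1 / c))))\<^sup>2"
    using c r by simp
  also have "\<dots> \<le> \<delta>\<^sup>2"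
    using dev(2) c r unfolding \<delta>_def by (intro power_mono) auto
  finally have "(real S / real n)\<^sup>2 * (r / (8 * (3 + 1 / c))) \<le> m\<^sup>2"
    unfolding m_def power_mult_distrib by (intro mult_left_mono) auto
  moreover have "(real S / real n)\<^sup>2 * (r / (8 * (3 + 1 / c)))
      = 1 / (8 * (3 + 1 / c)) * (real S / real n)"
    using S n by (simp add: r_def power2_eq_square)
  ultimately have "ennreal (1 / (8 * (3 + 1 / c)) * (real S / real n))
      \<le> ennreal (measure_pmf.expectation (poisson_sample S n u) (\<lambda>X. (Z X)\<^sup>2))"
    using jensen by (intro ennreal_leI) linarith
  also have "\<dots> = plugin_risk S n u u"
    using nn_integral_eq_integral[OF Z2] by (simp add: plugin_risk_def l1_uu Z_def)
  finally show "ennreal (1 / (8 * (3 + 1 / c)) * (real S / real n)) \<le> plugin_risk S n u u" .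
qed

theorem corollary1:
  fixes c :: real
  assumes "c > 0"
  shows "\<exists>a A :: real. 0 < a \<and> a \<le> A \<and>
    (\<forall>S n :: nat. S > 0 \<and> n > 0 \<and> real n \<ge> c * real S \<longrightarrow>
      ennreal (a * (real S / real n))
        \<le> (SUP (P, Q) \<in> prob_vectors S \<times> prob_vectors S. plugin_risk S n P Q) \<and>
      (SUP (P, Q) \<in> prob_vectors S \<times> prob_vectors S. plugin_risk S n P Q)
        \<le> ennreal (A * (real S / real n)))"
proof (rule exI[of _ "1 / (8 * (3 + 1 / c))"], rule exI[of _ 1],
    intro conjI allI impI; (elim conjE)?)
  define x where "x = 1 / c"
  have "x > 0" using assms by (simp add: x_def)
  then show "0 < 1 / (8 * (3 + 1 / c))" and "1 / (8 * (3 + 1 / c)) \<le> 1"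
    unfolding x_def[symmetric] by simp_all
next
  fix S n :: nat
  assume S: "S > 0" and n: "n > 0" and cS: "real n \<ge> c * real S"
  note low = plugin_risk_uniform_lower[OF assms S n cS]
  show "ennreal (1 / (8 * (3 + 1 / c)) * (real S / real n))
      \<le> (SUP (P, Q) \<in> prob_vectors S \<times> prob_vectors S. plugin_risk S n P Q)"
    by (rule order.trans[OF low(2)], rule SUP_upper2) (use low(1) in auto)
next
  fix S n :: nat
  assume "n > 0"
  then show "(SUP (P, Q) \<in> prob_vectors S \<times> prob_vectors S. plugin_risk S n P Q)
      \<le> ennreal (1 * (real S / real n))"
    by (auto intro!: SUP_least plugin_risk_upper)
qed

end
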